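(* Let $A$ and $B$ be arch systems with $A \sim B$. Then $\mathrm{Av}(A)$ and $\mathrm{Av}(B)$ are Wilf-equivalent, i.e. for every $n \ge 0$ the number of arch systems with $n$ arches avoiding $A$ equals the number of arch systems with $n$ arches avoiding $B$.
   Context: An arch system of size $n$ is a set of $n$ arches drawn above a horizontal baseline, connecting $2n$ points on the baseline so that every point is an endpoint of exactly one arch and no two arches cross (equivalently, a well-parenthesized word with $n$ pairs of parentheses; only the combinatorial configuration matters). The empty arch system has size $0$. An arch system $B$ is contained in (is a subsystem of) $A$ if $B$ can be obtained from $A$ by deleting some arches; otherwise $A$ avoids $B$. $\mathrm{Av}(A)$ denotes the set of arch systems avoiding $A$. The concatenation $AB$ is obtained by drawing $B$ to the right of $A$ on the same baseline. An atom is a non-empty arch system that is not a concatenation of two non-empty arch systems; every atom has the form $\langle A\rangle$, obtained from an arch system $A$ (its contents) by adding one arch enclosing all of $A$. The relation $\sim$ is the finest equivalence relation on arch systems such that, for all arch systems $A,B,P,Q$ and all $a,b,c$ each of which is an atom or the empty arch system: (R1) $A\sim B \Rightarrow \langle A\rangle \sim \langle B\rangle$; (R2) $a \sim b \Rightarrow PaQ \sim PbQ$; (R3) $PabQ \sim PbaQ$; (R4) $a\langle bc\rangle \sim \langle ab\rangle c$. *)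

theory Defs
  imports Main
begin

text \<open>
  Arch systems are encoded as well-parenthesized words: every arch contributes an opening
  parenthesis at its left endpoint and a closing one at its right endpoint.  Thus equality of
  words is equality of configurations and concatenation of arch systems is list append.
\<close>

datatype paren = Opening | Closing

definition enclose :: "paren list \<Rightarrow> paren list" where
  "enclose A = Opening # A @ [Closing]"

inductive arch_system :: "paren list \<Rightarrow> bool" where
  empty: "arch_system []"
| enclose: "arch_system A \<Longrightarrow> arch_system (enclose A)"
| concat: "arch_system A \<Longrightarrow> arch_system B \<Longrightarrow> arch_system (A @ B)"

definition arch_size :: "paren list \<Rightarrow> nat" where
  "arch_size A = count_list A Opening"

definition atom :: "paren list \<Rightarrow> bool" where
  "atom A \<longleftrightarrow> arch_system A \<and> A \<noteq> [] \<and>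
     \<not> (\<exists>B C. arch_system B \<and> arch_system C \<and> B \<noteq> [] \<and> C \<noteq> [] \<and> A = B @ C)"

definition atom_or_empty :: "paren list \<Rightarrow> bool" where
  "atom_or_empty A \<longleftrightarrow> atom A \<or> A = []"

text \<open>
  Two parentheses of an arch system belong to the same arch iff the word strictly between them is
  well-parenthesized.  The outer factors \<open>P\<close> and \<open>Q\<close> are arbitrary words,
  since the deleted arch may lie beneath other arches.
\<close>

inductive delete_arch :: "paren list \<Rightarrow> paren list \<Rightarrow> bool" where
  "arch_system W \<Longrightarrow> delete_arch (P @ enclose W @ Q) (P @ W @ Q)"

definition contained_in :: "paren list \<Rightarrow> paren list \<Rightarrow> bool" where
  "contained_in B A \<longleftrightarrow> arch_system A \<and> arch_system B \<and> delete_arch\<^sup>*\<^sup>* A B"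

definition Av :: "paren list \<Rightarrow> paren list set" where
  "Av A = {X. arch_system X \<and> \<not> contained_in A X}"

text \<open>
  The finest equivalence relation satisfying the four closure rules is obtained as the least
  relation closed under them and under reflexivity on arch systems, symmetry and transitivity.
\<close>

inductive arch_sim :: "paren list \<Rightarrow> paren list \<Rightarrow> bool" (infix "\<sim>" 50) where
  refl: "arch_system A \<Longrightarrow> A \<sim> A"
| sym: "A \<sim> B \<Longrightarrow> B \<sim> A"
| trans: "A \<sim> B \<Longrightarrow> B \<sim> C \<Longrightarrow> A \<sim> C"
| R1: "A \<sim> B \<Longrightarrow> enclose A \<sim> enclose B"
| R2: "\<lbrakk>arch_system P; arch_system Q; atom_or_empty a; atom_or_empty b; a \<sim> b\<rbrakk>
        \<Longrightarrow> P @ a @ Q \<sim> P @ b @ Q"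
| R3: "\<lbrakk>arch_system P; arch_system Q; atom_or_empty a; atom_or_empty b\<rbrakk>
        \<Longrightarrow> P @ a @ b @ Q \<sim> P @ b @ a @ Q"
| R4: "\<lbrakk>atom_or_empty a; atom_or_empty b; atom_or_empty c\<rbrakk>
        \<Longrightarrow> a @ enclose (b @ c) \<sim> enclose (a @ b) @ c"

definition wilf_equivalent :: "paren list set \<Rightarrow> paren list set \<Rightarrow> bool" where
  "wilf_equivalent C D \<longleftrightarrow>
     (\<forall>n. card {X \<in> C. arch_size X = n} = card {X \<in> D. arch_size X = n})"

lemma length_arch_system: "arch_system A \<Longrightarrow> length A = 2 * arch_size A"
  by (induction rule: arch_system.induct) (auto simp: arch_size_def enclose_def)

text \<open>The cardinalities in \<open>wilf_equivalent\<close> are those of finite sets.\<close>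

lemma finite_arch_systems_of_size: "finite {X. arch_system X \<and> arch_size X = n}"
proof (rule finite_subset)
  have "(UNIV :: paren set) = {Opening, Closing}"
    using paren.exhaust by blast
  then have "finite (UNIV :: paren set)"
    by (metis finite.emptyI finite.insertI)
  then show "finite {X :: paren list. set X \<subseteq> UNIV \<and> length X = 2 * n}"
    by (rule finite_lists_length_eq)
qed (auto simp: length_arch_system)

end

theory Submission
  imports Defs "HOL-Computational_Algebra.Formal_Power_Series"
begin

text \<open>
  Write an arch system as an ordered forest, so that containment becomes forest embedding, and let
  \<open>F(A)\<close> be the generating function of the avoiders of \<open>A\<close>. Enclosing gives
  \<open>F(\<langle>A\<rangle>) = 1 / (1 - x F(A))\<close>. For an atom \<open>a\<close>, cutting a forest at the first arch whose contents
  contain the contents of \<open>a\<close> relates the lists of \<open>r + 1\<close> forests containing \<open>aQ\<close> to those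
  containing \<open>Q\<close>. With \<open>h\<^sub>A(r)\<close> the generating function of the lists whose concatenation contains \<open>A\<close>,
  \<open>\<alpha> = F(a)\<close>, and \<open>(N h)(r) = x h(r + 1) + h(r - 1)\<close> (where \<open>h(-1) = 0\<close>), this reads
  \<open>(1 + x \<alpha>\<^sup>2 - \<alpha> N) h\<^bsub>aQ\<^esub> = (1 - \<alpha> + x \<alpha>\<^sup>2) h\<^sub>Q\<close>. The operators on the left are injective and
  commute, which gives (R2) and (R3). Finally \<open>F(ab) (1 - x F(a) F(b)) = F(a) + F(b) - F(a) F(b)\<close>
  makes \<open>F(a\<langle>bc\<rangle>)\<close> symmetric in \<open>F(a)\<close>, \<open>F(b)\<close>, \<open>F(c)\<close>, which gives (R4).
\<close>

unbundle fps_syntax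

section \<open>Forest embedding\<close>

text \<open>\<open>Arch Y X\<close> encodes \<open>\<langle>Y\<rangle>X\<close>.\<close>

datatype forest = Void | Arch forest forest

fun join :: "forest \<Rightarrow> forest \<Rightarrow> forest" (infixr "\<oplus>" 65) where
  "Void \<oplus> Z = Z"
| "Arch Y X \<oplus> Z = Arch Y (X \<oplus> Z)"

lemma join_Void [simp]: "X \<oplus> Void = X"
  by (induction X) auto

lemma join_assoc [simp]: "(X \<oplus> Y) \<oplus> Z = X \<oplus> Y \<oplus> Z"
  by (induction X) auto

lemma size_join [simp]: "size (X \<oplus> Y) = size X + size Y"
  by (induction X) auto

text \<open>The first arch of the target is either deleted, which releases its contents
  \<open>Y\<close>, or is the image of the first arch of the pattern. Each choice leaves smaller
  targets.\<close>

function emb :: "forest \<Rightarrow> forest \<Rightarrow> bool" where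
  "emb Void X \<longleftrightarrow> True"
| "emb (Arch A Q) Void \<longleftrightarrow> False"
| "emb (Arch A Q) (Arch Y X) \<longleftrightarrow> emb (Arch A Q) (Y \<oplus> X) \<or> emb A Y \<and> emb Q X"
  by pat_completeness auto
termination
  by (relation "measure (\<lambda>(A, X). size X)") auto

lemma emb_join: "emb A X \<Longrightarrow> emb B Y \<Longrightarrow> emb (A \<oplus> B) (X \<oplus> Y)"
proof (induction A X rule: emb.induct)
  case (1 X)
  \<comment> \<open>An empty first pattern is matched by deleting \<open>X\<close> arch by
    arch.\<close>
  have "emb B Y \<Longrightarrow> emb B (X \<oplus> Y)"
  proof (induction X rule: measure_induct_rule[where f = size])
    case (less X)
    show ?case
    proof (cases X)
      case (Arch V W)
      then show ?thesis using less.IH[of "V \<oplus> W"] less.prems by (cases B) auto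
    qed (use less in auto)
  qed
  then show ?case using 1 by simp
qed auto

lemma emb_joinL: "emb B X \<Longrightarrow> emb B (X \<oplus> Y)"
  using emb_join[of B X Void Y] by simp

lemma emb_joinR: "emb B Y \<Longrightarrow> emb B (X \<oplus> Y)"
  using emb_join[of Void X B Y] by simp

lemma emb_Arch_imp_join: "emb (Arch A Q) X \<Longrightarrow> emb (A \<oplus> Q) X"
proof (induction "Arch A Q" X rule: emb.induct)
  case (3 Y X)
  then have "emb (A \<oplus> Q) (Y \<oplus> X)" by (auto intro: emb_join)
  then show ?case by (cases "A \<oplus> Q") auto
qed auto

lemma emb_Arch_imp_rest: "emb (Arch A Q) X \<Longrightarrow> emb Q X"
proof (induction "Arch A Q" X rule: emb.induct)
  case (3 Y X)
  then have "emb Q (Y \<oplus> X)" by (auto intro: emb_joinR)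
  then show ?case by (cases Q) auto
qed auto

text \<open>The outer arch of an atom has a single image, and all that lies beneath it stays on the
  same side of the cut.\<close>

lemma emb_atom_join: "emb (Arch A Void) (X \<oplus> Y) \<longleftrightarrow> emb (Arch A Void) X \<or> emb (Arch A Void) Y"
proof (induction X rule: measure_induct_rule[where f = size])
  case (less X)
  show ?case
  proof (cases X)
    case (Arch V W)
    then show ?thesis using less[of "V \<oplus> W"] by auto
  qed auto
qed

lemma emb_atom_Arch:
  "emb (Arch A Void) (Arch Y X) \<longleftrightarrow> emb A Y \<or> emb (Arch A Void) X"
  using emb_Arch_imp_join[of A Void Y] by (auto simp: emb_atom_join)

text \<open>If the first pattern arch were matched inside \<open>T\<close>, that arch with its
  contents would be a copy of \<langle>A\<rangle> in \<open>T\<close>.\<close>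

lemma emb_drop_avoiding:
  "\<not> emb (Arch A Void) T \<Longrightarrow> emb (Arch A Q) (T \<oplus> X) \<longleftrightarrow> emb (Arch A Q) X"
proof (induction T rule: measure_induct_rule[where f = size])
  case (less T)
  show ?case
  proof (cases T)
    case (Arch V W)
    then show ?thesis using less.IH[of "V \<oplus> W"] less.prems by auto
  qed auto
qed

lemma emb_Arch_imp_atom: "emb (Arch A Q) X \<Longrightarrow> emb (Arch A Void) X"
  using emb_drop_avoiding[of A X Q Void] by auto

text \<open>The arch over \<open>Y\<close> can serve as image of the first pattern arch. Any other
  occurrence skips \<open>Y\<close> and starts in \<open>X\<close>, so it places \<open>Q\<close> in
  \<open>X\<close> as well.\<close>

lemma emb_first_arch_minimal:
  assumes "emb A Y" "\<not> emb (Arch A Void) Y"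
  shows "emb (Arch A Q) (Arch Y X) \<longleftrightarrow> emb Q X"
  using assms emb_drop_avoiding[OF assms(2)] emb_Arch_imp_rest by auto

text \<open>The arch over \<open>Y\<close> gains nothing as an image of the first pattern arch: the
  copy of \<langle>A\<rangle> inside \<open>Y\<close> can replace it.\<close>

lemma emb_first_arch_open:
  assumes "emb (Arch A Void) Y"
  shows "emb (Arch A Q) (Arch Y X) \<longleftrightarrow> emb (Arch A Q) (Y \<oplus> X)"
  using emb_join[OF assms, of Q X] by auto

text \<open>The image of the second atom lies entirely in \<open>Y\<close> or in \<open>U\<close>;
  in the latter case the copy of \<langle>A\<rangle> in \<open>Y\<close> serves as first
  atom.\<close>

lemma emb_pair_join:
  assumes "emb (Arch A Void) Y"
  shows "emb (Arch A (Arch B Void)) (Y \<oplus> U) \<longleftrightarrow>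
    emb (Arch A (Arch B Void)) Y \<or> emb (Arch B Void) U"
proof
  show "emb (Arch A (Arch B Void)) Y \<or> emb (Arch B Void) U \<Longrightarrow>
      emb (Arch A (Arch B Void)) (Y \<oplus> U)"
    using emb_join[OF assms, of "Arch B Void" U] emb_joinL by auto
next
  show "emb (Arch A (Arch B Void)) (Y \<oplus> U) \<Longrightarrow>
      emb (Arch A (Arch B Void)) Y \<or> emb (Arch B Void) U"
  proof (induction Y rule: measure_induct_rule[where f = size])
    case (less Y)
    show ?case
    proof (cases Y)
      case Void
      then show ?thesis using less.prems emb_Arch_imp_rest by auto
    next
      case (Arch V W)
      then show ?thesis
        using less.IH[of "V \<oplus> W"] less.prems emb_atom_join[of B W U] by auto
    qed
  qed
qed

text \<open>A forest avoids \<langle>A\<rangle> exactly when the contents of all its top-level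
  arches avoid \<open>A\<close>, so the cut is at the leftmost top-level arch with \<open>A\<close>
  in its contents. This makes the later counting maps injective.\<close>

lemma first_occurrence_unique:
  assumes "\<not> emb (Arch A Void) T" "\<not> emb (Arch A Void) T'" "emb A Y" "emb A Y'"
    and "T \<oplus> Arch Y U = T' \<oplus> Arch Y' U'"
  shows "T = T' \<and> Y = Y' \<and> U = U'"
  using assms
proof (induction T arbitrary: T')
  case Void
  then show ?case by (cases T') auto
next
  case (Arch V W)
  then show ?case by (cases T') (auto simp: emb_atom_Arch simp del: emb.simps(3))
qed

lemma first_occurrence_exists:
  assumes "emb (Arch A Void) S"
  obtains T Y U where "S = T \<oplus> Arch Y U" "\<not> emb (Arch A Void) T" "emb A Y"
  using assms
proof (induction S arbitrary: thesis)
  case (Arch V W)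
  show ?case
  proof (cases "emb A V")
    case True
    then show ?thesis using Arch.prems(1)[of Void V W] by auto
  next
    case False
    then have "emb (Arch A Void) W"
      using Arch.prems(2) by (simp add: emb_atom_Arch del: emb.simps(3))
    then obtain T Y U where "W = T \<oplus> Arch Y U" "\<not> emb (Arch A Void) T" "emb A Y"
      using Arch.IH(2) by blast
    then show ?thesis
      using Arch.prems(1)[of "Arch V T" Y U] False
      by (simp add: emb_atom_Arch del: emb.simps(3))
  qed
qed auto

section \<open>Arch systems as forests\<close>

fun word :: "forest \<Rightarrow> paren list" where
  "word Void = []"
| "word (Arch Y X) = enclose (word Y) @ word X"

lemma word_join [simp]: "word (X \<oplus> Y) = word X @ word Y"
  by (induction X) auto

lemma arch_system_word [simp]: "arch_system (word X)"
  by (induction X) (auto intro: arch_system.intros)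

lemma arch_system_imp_word: "arch_system A \<Longrightarrow> \<exists>X. A = word X"
proof (induction rule: arch_system.induct)
  case empty
  then show ?case by (metis word.simps(1))
next
  case (enclose A)
  then obtain X where "A = word X" by blast
  then have "enclose A = word (Arch X Void)" by simp
  then show ?case by blast
next
  case (concat A B)
  then show ?case by (metis word_join)
qed

lemma arch_size_word [simp]: "arch_size (word X) = size X"
  by (induction X) (auto simp: arch_size_def enclose_def)

section \<open>Balance of parentheses and unique parsing\<close>

lemma count_word_Closing: "count_list (word X) Closing = count_list (word X) Opening"
  by (induction X) (auto simp: enclose_def)

lemma prefix_word_count:
  "word X = P @ Q \<Longrightarrow> count_list P Closing \<le> count_list P Opening"
proof (induction X arbitrary: P Q)
  case (Arch Y X)
  show ?case
  proof (cases P)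
    case (Cons p P')
    with Arch.prems have p: "p = Opening" and "word Y @ Closing # word X = P' @ Q"
      by (auto simp: enclose_def)
    then consider (inner) R where "word Y = P' @ R"
      | (outer) R where "P' = word Y @ Closing # R" "word X = R @ Q"
      by (auto simp: append_eq_append_conv2 Cons_eq_append_conv)
    then show ?thesis
    proof cases
      case inner
      then show ?thesis using Arch.IH(1)[of P' R] Cons p by auto
    next
      case outer
      then show ?thesis
        using Arch.IH(2)[of R Q] Cons p count_word_Closing[of Y] by auto
    qed
  qed auto
qed auto

text \<open>Two arches cannot interleave: a suffix of a balanced word has at least as many closing
  as opening parentheses, while a nonempty proper prefix of an enclosed word has strictly more
  opening ones.\<close>

lemma no_overlap:
  assumes "word Y = P @ Z" "Z \<noteq> []" "enclose (word W) = Z @ R" "R \<noteq> []"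
  shows False
proof -
  obtain Z' where Z': "Z = Opening # Z'" "word W @ [Closing] = Z' @ R"
    using assms(2,3) by (cases Z) (auto simp: enclose_def)
  obtain R' where "word W = Z' @ R'"
    using Z'(2) assms(4) by (metis append_assoc append_butlast_last_id butlast_append butlast_snoc)
  then have "count_list Z Closing < count_list Z Opening"
    using prefix_word_count[of W Z' R'] Z' by simp
  moreover have "count_list P Closing \<le> count_list P Opening"
    using assms(1) prefix_word_count by blast
  ultimately show False
    using count_word_Closing[of Y] assms(1) by simp
qed

text \<open>The displayed \<open>Closing\<close> is the first unmatched one, which fixes where the
  leading forest ends.\<close>

lemma first_return_unique:
  assumes "word Y @ Closing # R = word W @ Closing # Q"
  shows "Y = W \<and> R = Q"
  using assms
proof (induction Y arbitrary: W R Q)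
  case Void
  then show ?case by (cases W) (auto simp: enclose_def)
next
  case (Arch Y X)
  from Arch.prems obtain Y' X' where W: "W = Arch Y' X'"
    by (cases W) (auto simp: enclose_def)
  with Arch.prems have *: "word Y @ Closing # (word X @ Closing # R) = word Y' @ Closing # (word X' @ Closing # Q)"
    by (simp add: enclose_def)
  then show ?case using Arch.IH W by blast
qed

lemma inj_word: "inj word"
proof (rule injI)
  fix X Y assume "word X = word Y"
  then show "X = Y" using first_return_unique[of X "[]" Y "[]"] by simp
qed

section \<open>Deleting arches, on forests and on words\<close>

inductive delete_node :: "forest \<Rightarrow> forest \<Rightarrow> bool" where
  root: "delete_node (Arch Y X) (Y \<oplus> X)"
| inside: "delete_node Y Y' \<Longrightarrow> delete_node (Arch Y X) (Arch Y' X)"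
| rest: "delete_node X X' \<Longrightarrow> delete_node (Arch Y X) (Arch Y X')"

lemma delete_node_joinL: "delete_node X X' \<Longrightarrow> delete_node (X \<oplus> Z) (X' \<oplus> Z)"
  by (induction rule: delete_node.induct) (auto intro: delete_node.intros)

lemma delete_node_joinR: "delete_node X X' \<Longrightarrow> delete_node (Z \<oplus> X) (Z \<oplus> X')"
  by (induction Z) (auto intro: delete_node.intros)

text \<open>A deletion at the root is the first alternative of \<open>emb\<close>; a deeper one
  persists in the opened forest and in the component where it happens. Induction is on size because
  the opened forest is not a subterm.\<close>

lemma emb_delete_node: "delete_node X X' \<Longrightarrow> emb B X' \<Longrightarrow> emb B X"
proof (induction X arbitrary: X' B rule: measure_induct_rule[where f = size])
  case (less X)
  show ?case
  proof (cases B)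
    case (Arch A Q)
    from less.prems(1) show ?thesis
    proof cases
      case (root V W)
      then show ?thesis using less.prems(2) Arch by simp
    next
      case (inside V V' W)
      then consider "emb B (V' \<oplus> W)" | "emb A V'" "emb Q W"
        using less.prems(2) Arch by auto
      then have "emb B (V \<oplus> W) \<or> emb A V \<and> emb Q W"
      proof cases
        case 1
        then show ?thesis
          using less.IH[OF _ delete_node_joinL[OF inside(3)]] inside(1) by simp
      next
        case 2
        then show ?thesis using less.IH[OF _ inside(3)] inside(1) by simp
      qed
      then show ?thesis using Arch inside(1) by simp
    next
      case (rest W W' V)
      then consider "emb B (V \<oplus> W')" | "emb A V" "emb Q W'"
        using less.prems(2) Arch by auto
      then have "emb B (V \<oplus> W) \<or> emb A V \<and> emb Q W"
      proof cases
        case 1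
        then show ?thesis
          using less.IH[OF _ delete_node_joinR[OF rest(3)]] rest(1) by simp
      next
        case 2
        then show ?thesis using less.IH[OF _ rest(3)] rest(1) by simp
      qed
      then show ?thesis using Arch rest(1) by simp
    qed
  qed auto
qed

text \<open>The factor is located relative to the first arch of \<open>X\<close>: it starts at the
  opening parenthesis, behind the arch, at the closing parenthesis (impossible), or within the
  contents, where \<open>no_overlap\<close> forces it to end too.\<close>

lemma word_delete_node:
  "word X = P @ enclose (word W) @ Q \<Longrightarrow> \<exists>X'. delete_node X X' \<and> word X' = P @ word W @ Q"
proof (induction X arbitrary: P Q)
  case Void
  then show ?case by (auto simp: enclose_def)
next
  case (Arch Y X)
  show ?case
  proof (cases P)
    case Nil
    then have "word Y @ Closing # word X = word W @ Closing # Q"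
      using Arch.prems by (simp add: enclose_def)
    then have "Y = W" "word X = Q" using first_return_unique by blast+
    then show ?thesis using Nil delete_node.root[of Y X] by (intro exI[of _ "Y \<oplus> X"]) auto
  next
    case (Cons p P')
    with Arch.prems have p: "p = Opening"
      and eq: "word Y @ Closing # word X = P' @ enclose (word W) @ Q"
      by (auto simp: enclose_def)
    from eq consider
        (outer) R where "P' = word Y @ Closing # R" "word X = R @ enclose (word W) @ Q"
      | (zero) "Closing # word X = enclose (word W) @ Q"
      | (inner) Z where "word Y = P' @ Z" "Z \<noteq> []" "Z @ Closing # word X = enclose (word W) @ Q"
      unfolding append_eq_append_conv2 Cons_eq_append_conv by force
    then show ?thesis
    proof cases
      case outer
      then obtain X' where "delete_node X X'" "word X' = R @ word W @ Q"
        using Arch.IH(2) by blast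
      then show ?thesis using outer Cons p
        by (intro exI[of _ "Arch Y X'"]) (auto intro: delete_node.intros simp: enclose_def)
    next
      case zero
      then show ?thesis by (simp add: enclose_def)
    next
      case inner
      obtain R where R: "Z = enclose (word W) @ R \<and> R @ Closing # word X = Q \<or>
          Z @ R = enclose (word W) \<and> Closing # word X = R @ Q"
        using inner(3) append_eq_append_conv2[of Z "Closing # word X" "enclose (word W)" Q] by blast
      consider (over) "enclose (word W) = Z @ R" "R \<noteq> []" "enclose (word W) = Z @ R" "R \<noteq> []"
        | (within) U where "Z = enclose (word W) @ U" "Q = U @ Closing # word X"
        using R by (metis append_Nil append_Nil2)
      then show ?thesis
      proof cases
        case over
        then show ?thesis using no_overlap inner by blast
      next
        case within
        then obtain Y' where "delete_node Y Y'" "word Y' = P' @ word W @ U"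
          using Arch.IH(1)[of P' U] inner(1) by auto
        then show ?thesis using within Cons p
          by (intro exI[of _ "Arch Y' X"]) (auto intro: delete_node.intros simp: enclose_def)
      qed
    qed
  qed
qed

lemma delete_arch_word:
  assumes "delete_arch (word X) V"
  obtains X' where "delete_node X X'" "V = word X'"
  using assms
proof cases
  case (1 W P Q)
  then obtain U where "W = word U" using arch_system_imp_word by blast
  then show ?thesis using 1 that word_delete_node by metis
qed

lemma delete_arch_context: "delete_arch A B \<Longrightarrow> delete_arch (P @ A @ Q) (P @ B @ Q)"
proof (induction rule: delete_arch.induct)
  case (1 W P' Q')
  then show ?case using delete_arch.intros[of W "P @ P'" "Q' @ Q"] by simp
qed

lemma delete_archs_context: "delete_arch\<^sup>*\<^sup>* A B \<Longrightarrow> delete_arch\<^sup>*\<^sup>* (P @ A @ Q) (P @ B @ Q)"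
  by (induction rule: rtranclp_induct) (auto intro: rtranclp.rtrancl_into_rtrancl delete_arch_context)

lemma delete_archs_append:
  "delete_arch\<^sup>*\<^sup>* A A' \<Longrightarrow> delete_arch\<^sup>*\<^sup>* B B' \<Longrightarrow> delete_arch\<^sup>*\<^sup>* (A @ B) (A' @ B')"
  using delete_archs_context[of A A' "[]" B] delete_archs_context[of B B' A' "[]"] by auto

lemma delete_archs_enclose: "delete_arch\<^sup>*\<^sup>* A B \<Longrightarrow> delete_arch\<^sup>*\<^sup>* (enclose A) (enclose B)"
  using delete_archs_context[of A B "[Opening]" "[Closing]"] by (simp add: enclose_def)

lemma delete_arch_first: "delete_arch (word (Arch Y X)) (word (Y \<oplus> X))"
  using delete_arch.intros[of "word Y" "[]" "word X"] by simp

lemma emb_imp_delete_archs: "emb A X \<Longrightarrow> delete_arch\<^sup>*\<^sup>* (word X) (word A)"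
proof (induction A X rule: emb.induct)
  case (1 X)
  \<comment> \<open>Repeatedly deleting the first arch leads to the empty word.\<close>
  show ?case
  proof (induction X rule: measure_induct_rule[where f = size])
    case (less X)
    show ?case
    proof (cases X)
      case (Arch Y Z)
      then have "delete_arch\<^sup>*\<^sup>* (word (Y \<oplus> Z)) (word Void)"
        using less[of "Y \<oplus> Z"] by simp
      then show ?thesis using Arch delete_arch_first[of Y Z] by (metis converse_rtranclp_into_rtranclp)
    qed auto
  qed
next
  case (3 A Q Y X)
  from 3(4) consider "emb (Arch A Q) (Y \<oplus> X)" | "emb A Y" "emb Q X" by auto
  then show ?case
  proof cases
    case 1
    then show ?thesis
      using 3(1) delete_arch_first[of Y X] by (metis converse_rtranclp_into_rtranclp)
  next
    case 2
    then show ?thesis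
      using 3(2,3) delete_archs_append[OF delete_archs_enclose] by simp
  qed
qed auto

lemma delete_archs_imp_emb:
  "delete_arch\<^sup>*\<^sup>* V (word A) \<Longrightarrow> V = word X \<Longrightarrow> emb A X"
proof (induction arbitrary: X rule: converse_rtranclp_induct)
  case base
  have "emb A A"
    by (induction A) auto
  then show ?case using base inj_word by (metis injD)
next
  case (step V V')
  then obtain X' where "delete_node X X'" "V' = word X'"
    using delete_arch_word by blast
  then show ?case using step.IH emb_delete_node by blast
qed

lemma contained_in_word: "contained_in (word A) (word X) \<longleftrightarrow> emb A X"
  unfolding contained_in_def using emb_imp_delete_archs delete_archs_imp_emb by auto

lemma atom_word:
  assumes "atom a"
  obtains Y where "a = word (Arch Y Void)"
proof -
  obtain X where a: "a = word X" using assms arch_system_imp_word unfolding atom_def by blast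
  moreover have "X \<noteq> Void" using a assms unfolding atom_def by auto
  ultimately obtain Y Z where YZ: "X = Arch Y Z" by (cases X) auto
  have "word Z = []"
  proof (rule ccontr)
    assume "word Z \<noteq> []"
    moreover have "arch_system (enclose (word Y))" "enclose (word Y) \<noteq> []"
      by (auto intro: arch_system.intros) (simp add: enclose_def)
    moreover have "a = enclose (word Y) @ word Z" using a YZ by simp
    ultimately show False using assms arch_system_word unfolding atom_def by blast
  qed
  then have "Z = Void" by (cases Z) (auto simp: enclose_def)
  then show thesis using a YZ that by blast
qed

section \<open>Generating functions\<close>

text \<open>Integer coefficients allow complements to be subtracted. As \<open>card\<close> of an
  infinite set is 0, the sum, difference and product rules below assume
  \<open>finite_levels\<close>.\<close>

definition gf :: "('a \<Rightarrow> nat) \<Rightarrow> 'a set \<Rightarrow> int fps" where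
  "gf w S = Abs_fps (\<lambda>n. int (card {x \<in> S. w x = n}))"

definition finite_levels :: "('a \<Rightarrow> nat) \<Rightarrow> 'a set \<Rightarrow> bool" where
  "finite_levels w S \<longleftrightarrow> (\<forall>n. finite {x \<in> S. w x = n})"

lemma gf_nth: "gf w S $ n = int (card {x \<in> S. w x = n})"
  by (simp add: gf_def)

lemma finite_levels_subset: "finite_levels w T \<Longrightarrow> S \<subseteq> T \<Longrightarrow> finite_levels w S"
  unfolding finite_levels_def by (auto elim!: finite_subset[rotated])

lemma gf_Un:
  assumes "finite_levels w S" "finite_levels w T" "S \<inter> T = {}"
  shows "gf w (S \<union> T) = gf w S + gf w T"
proof (rule fps_ext)
  fix n
  have "{x \<in> S \<union> T. w x = n} = {x \<in> S. w x = n} \<union> {x \<in> T. w x = n}" by blast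
  moreover have "{x \<in> S. w x = n} \<inter> {x \<in> T. w x = n} = {}" using assms(3) by blast
  ultimately show "gf w (S \<union> T) $ n = (gf w S + gf w T) $ n"
    using assms(1,2) by (simp add: gf_nth finite_levels_def card_Un_disjoint)
qed

lemma gf_Diff:
  assumes "finite_levels w S" "T \<subseteq> S"
  shows "gf w (S - T) = gf w S - gf w T"
proof -
  have "finite_levels w (S - T)" "finite_levels w T"
    using assms by (auto intro: finite_levels_subset)
  then have "gf w (S - T \<union> T) = gf w (S - T) + gf w T"
    by (rule gf_Un) blast
  moreover have "S - T \<union> T = S" using assms(2) by blast
  ultimately show ?thesis by simp
qed

lemma gf_image:
  assumes "inj_on f S" "\<And>x. x \<in> S \<Longrightarrow> w' (f x) = w x"
  shows "gf w' (f ` S) = gf w S"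
proof (rule fps_ext)
  fix n
  have "{y \<in> f ` S. w' y = n} = f ` {x \<in> S. w x = n}" using assms(2) by auto
  moreover have "inj_on f {x \<in> S. w x = n}" using assms(1) by (rule inj_on_subset) auto
  ultimately show "gf w' (f ` S) $ n = gf w S $ n" by (simp add: gf_nth card_image)
qed

lemma gf_Suc: "gf (\<lambda>x. Suc (w x)) S = fps_X * gf w S"
proof (rule fps_ext)
  fix n
  show "gf (\<lambda>x. Suc (w x)) S $ n = (fps_X * gf w S) $ n"
    by (cases n) (simp_all add: gf_nth)
qed

lemma level_Times:
  fixes w :: "'a \<Rightarrow> nat" and v :: "'b \<Rightarrow> nat"
  shows "{z \<in> S \<times> T. w (fst z) + v (snd z) = n} =
    (\<Union>i\<in>{0..n}. {x \<in> S. w x = i} \<times> {y \<in> T. v y = n - i})"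
  by force

lemma finite_levels_Times:
  assumes "finite_levels w S" "finite_levels v T"
  shows "finite_levels (\<lambda>z. w (fst z) + v (snd z)) (S \<times> T)"
  using assms unfolding finite_levels_def level_Times by blast

lemma gf_Times:
  assumes "finite_levels w S" "finite_levels v T"
  shows "gf (\<lambda>z. w (fst z) + v (snd z)) (S \<times> T) = gf w S * gf v T"
proof (rule fps_ext)
  fix n
  have "card (\<Union>i\<in>{0..n}. {x \<in> S. w x = i} \<times> {y \<in> T. v y = n - i}) =
      (\<Sum>i=0..n. card ({x \<in> S. w x = i} \<times> {y \<in> T. v y = n - i}))"
    using assms unfolding finite_levels_def by (intro card_UN_disjoint) auto
  then show "gf (\<lambda>z. w (fst z) + v (snd z)) (S \<times> T) $ n = (gf w S * gf v T) $ n"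
    unfolding gf_nth level_Times fps_mult_nth by (simp add: card_cartesian_product)
qed

lemma mem_image_Times:
  "z \<in> case_prod g ` (S \<times> T) \<longleftrightarrow> (\<exists>x\<in>S. \<exists>y\<in>T. z = g x y)"
  by force

definition weight :: "forest list \<Rightarrow> nat" where
  "weight Xs = sum_list (map size Xs)"

lemma weight_simps [simp]: "weight [] = 0" "weight (X # Xs) = size X + weight Xs"
  by (simp_all add: weight_def)

lemma finite_levels_forest: "finite_levels size (S :: forest set)"
proof -
  have "finite {X :: forest. size X = n}" for n
  proof (rule finite_imageD[where f = word])
    show "finite (word ` {X. size X = n})"
      by (rule finite_subset[OF _ finite_arch_systems_of_size[of n]]) auto
    show "inj_on word {X. size X = n}" using inj_word by (rule inj_on_subset) auto
  qed
  then show ?thesis by (auto simp: finite_levels_def)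
qed

text \<open>Without a fixed length, padding with \<open>Void\<close> would give infinitely many
  lists of the same weight.\<close>

lemma finite_levels_forest_lists: "\<forall>Xs\<in>S. length Xs = n \<Longrightarrow> finite_levels weight S"
proof -
  have "finite_levels weight {Xs. length Xs = n}"
  proof (induction n)
    case 0
    then show ?case by (auto simp: finite_levels_def)
  next
    case (Suc n)
    have "{Xs \<in> {Xs. length Xs = Suc n}. weight Xs = k} =
        case_prod (#) ` {z \<in> UNIV \<times> {Xs. length Xs = n}. size (fst z) + weight (snd z) = k}" for k
      by (auto simp: length_Suc_conv image_iff)
    then show ?case
      using finite_levels_Times[OF finite_levels_forest Suc, of UNIV]
      by (simp add: finite_levels_def)
  qed
  then show "\<forall>Xs\<in>S. length Xs = n \<Longrightarrow> finite_levels weight S"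
    by (auto intro: finite_levels_subset)
qed

section \<open>Avoiders of a pattern and of an atom\<close>

definition avoiders :: "forest \<Rightarrow> forest set" where
  "avoiders A = {X. \<not> emb A X}"

abbreviation av_gf :: "forest \<Rightarrow> int fps" where
  "av_gf A \<equiv> gf size (avoiders A)"

lemma av_gf_Void: "av_gf Void = 0"
  by (rule fps_ext) (simp add: gf_nth avoiders_def)

text \<open>\<open>Void\<close> is the only forest of size 0. Compared with
  \<open>av_gf_Void\<close>, this shows that the series detects whether the pattern is
  empty.\<close>

lemma av_gf_nth_0:
  assumes "A \<noteq> Void"
  shows "av_gf A $ 0 = 1"
proof -
  obtain B Q where A: "A = Arch B Q" using assms by (cases A) auto
  have "X \<in> avoiders A \<and> size X = 0 \<longleftrightarrow> X = Void" for X
    unfolding A avoiders_def by (cases X) simp_all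
  then have "{X \<in> avoiders A. size X = 0} = {Void}" by (simp only: singleton_conv)
  then show ?thesis by (simp add: gf_nth)
qed

lemma gf_Void: "gf size {Void :: forest} = 1"
proof (rule fps_ext)
  fix n
  have "{X \<in> {Void :: forest}. size X = n} = (if n = 0 then {Void} else {})" by auto
  then show "gf size {Void :: forest} $ n = 1 $ n" by (simp add: gf_nth)
qed

text \<open>A nonempty avoider of \<langle>A\<rangle> is a first arch over an avoider of
  \<open>A\<close>, followed by another avoider of \<langle>A\<rangle>; the arch itself gives the
  factor \<open>fps_X\<close>.\<close>

lemma av_gf_Arch: "av_gf (Arch A Void) = 1 + fps_X * av_gf A * av_gf (Arch A Void)"
proof -
  define f where "f = (\<lambda>(Y, X). Arch Y X)"
  define S where "S = avoiders A \<times> avoiders (Arch A Void)"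
  have *: "avoiders (Arch A Void) = {Void} \<union> f ` S"
  proof (rule set_eqI)
    fix X
    show "X \<in> avoiders (Arch A Void) \<longleftrightarrow> X \<in> {Void} \<union> f ` S"
      unfolding f_def S_def
      by (cases X) (auto simp: avoiders_def emb_atom_Arch mem_image_Times simp del: emb.simps(3))
  qed
  have "gf size ({Void} \<union> f ` S) = gf size {Void} + gf size (f ` S)"
    by (intro gf_Un finite_levels_forest) (auto simp: f_def)
  moreover have "gf size (f ` S) = gf (\<lambda>z. Suc (size (fst z) + size (snd z))) S"
    by (rule gf_image) (auto simp: inj_on_def f_def)
  moreover have "\<dots> = fps_X * (av_gf A * av_gf (Arch A Void))"
    unfolding gf_Suc S_def by (simp only: gf_Times[OF finite_levels_forest finite_levels_forest])
  ultimately have "gf size ({Void} \<union> f ` S) = 1 + fps_X * av_gf A * av_gf (Arch A Void)"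
    by (simp only: gf_Void mult.assoc)
  then show ?thesis by (rule HOL.trans[OF arg_cong[where f = "gf size", OF *]])
qed

section \<open>Peeling off the first atom of a pattern\<close>

definition joins :: "forest list \<Rightarrow> forest" where
  "joins Xs = foldr join Xs Void"

lemma joins_simps [simp]: "joins [] = Void" "joins (X # Xs) = X \<oplus> joins Xs"
  by (simp_all add: joins_def)

text \<open>
  Lists of \<open>r + 1\<close> forests stand for words with \<open>r\<close> unmatched closing parentheses: what remains of
  an arch system to the right of a point lying beneath \<open>r\<close> arches.
\<close>

definition occ_lists :: "nat \<Rightarrow> forest \<Rightarrow> forest list set" where
  "occ_lists r A = {Xs. length Xs = Suc r \<and> emb A (joins Xs)}"

definition occ_gf :: "forest \<Rightarrow> nat \<Rightarrow> int fps" where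
  "occ_gf A r = gf weight (occ_lists r A)"

definition early_lists :: "forest \<Rightarrow> forest \<Rightarrow> nat \<Rightarrow> forest list set" where
  "early_lists A Q r = {Xs \<in> occ_lists r (Arch A Q). emb (Arch A Void) (hd Xs)}"

lemma finite_levels_occ_lists: "finite_levels weight (occ_lists r A)"
  by (rule finite_levels_forest_lists[of _ "Suc r"]) (simp add: occ_lists_def)

lemma finite_levels_early_lists: "finite_levels weight (early_lists A Q r)"
  by (rule finite_levels_forest_lists[of _ "Suc r"]) (simp add: early_lists_def occ_lists_def)

lemma occ_gf_split:
  "occ_gf (Arch A Q) r = gf weight (early_lists A Q r) +
     av_gf (Arch A Void) * (case r of 0 \<Rightarrow> 0 | Suc r' \<Rightarrow> occ_gf (Arch A Q) r')"
proof (cases r)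
  case 0
  have "occ_lists 0 (Arch A Q) = early_lists A Q 0"
    using emb_Arch_imp_atom[of A Q] by (auto simp: occ_lists_def early_lists_def length_Suc_conv)
  then show ?thesis using 0 by (simp add: occ_gf_def)
next
  case (Suc r')
  let ?S = "avoiders (Arch A Void) \<times> occ_lists r' (Arch A Q)" and ?f = "\<lambda>(X, Xs). X # Xs"
  have "occ_lists r (Arch A Q) = early_lists A Q r \<union> ?f ` ?S"
  proof (rule set_eqI)
    fix Xs
    show "Xs \<in> occ_lists r (Arch A Q) \<longleftrightarrow> Xs \<in> early_lists A Q r \<union> ?f ` ?S"
    proof (cases Xs)
      case (Cons X Ys)
      then show ?thesis
        using emb_drop_avoiding[of A X Q "joins Ys"] Suc
        by (auto simp: occ_lists_def early_lists_def avoiders_def mem_image_Times)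
    qed (simp add: occ_lists_def early_lists_def mem_image_Times)
  qed
  moreover have "gf weight (early_lists A Q r \<union> ?f ` ?S) = gf weight (early_lists A Q r) + gf weight (?f ` ?S)"
  proof (rule gf_Un)
    show "finite_levels weight (?f ` ?S)"
      by (rule finite_levels_forest_lists[of _ "Suc r"]) (auto simp: occ_lists_def Suc)
    show "early_lists A Q r \<inter> ?f ` ?S = {}" by (auto simp: early_lists_def avoiders_def)
  qed (rule finite_levels_early_lists)
  moreover have "gf weight (?f ` ?S) = gf (\<lambda>z. size (fst z) + weight (snd z)) ?S"
    by (rule gf_image) (auto simp: inj_on_def)
  ultimately show ?thesis
    using Suc by (simp add: occ_gf_def gf_Times finite_levels_forest finite_levels_occ_lists)
qed

lemma gf_minimal:
  "gf size {Y. emb A Y \<and> \<not> emb (Arch A Void) Y} = av_gf (Arch A Void) - av_gf A"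
proof -
  have "{Y. emb A Y \<and> \<not> emb (Arch A Void) Y} = avoiders (Arch A Void) - avoiders A"
    by (auto simp: avoiders_def)
  moreover have "avoiders A \<subseteq> avoiders (Arch A Void)"
    using emb_Arch_imp_join[of A Void] by (auto simp: avoiders_def)
  ultimately show ?thesis by (simp add: gf_Diff finite_levels_forest)
qed

text \<open>The head is cut as \<open>T \<oplus> Arch Y U\<close> at its first occurrence, and the
  list grows to \<open>Y\<close>, \<open>U\<close> and the old tail. If \<open>Y\<close> contains
  \<langle>A\<rangle>, the arch over it can be opened and the new list is early again; otherwise
  this arch is matched and only \<open>Q\<close> remains to be found.\<close>

lemma gf_early_lists:
  fixes A Q :: forest and r :: nat
  defines "S \<equiv> early_lists A Q (Suc r) \<union>
      (\<lambda>(Y, Xs). Y # Xs) ` ({Y. emb A Y \<and> \<not> emb (Arch A Void) Y} \<times> occ_lists r Q)"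
  shows "gf weight (early_lists A Q r) =
    gf (\<lambda>z. Suc (size (fst z) + weight (snd z))) (avoiders (Arch A Void) \<times> S)"
proof -
  \<comment> \<open>\<open>f\<close> reverses the cut: the first two forests become the contents and
    the right neighbours of an arch placed after \<open>T\<close>.\<close>
  define f where "f = (\<lambda>(T, Xs). (T \<oplus> Arch (hd Xs) (hd (tl Xs))) # tl (tl Xs))"
  have S: "Xs \<in> S \<longleftrightarrow> (\<exists>Y U Zs. Xs = Y # U # Zs \<and> length Zs = r \<and> emb A Y \<and>
      emb (Arch A Q) (Arch Y (U \<oplus> joins Zs)))" for Xs
  proof -
    have "Xs \<in> S \<longleftrightarrow> (\<exists>Y U Zs. Xs = Y # U # Zs \<and> length Zs = r \<and>
      (emb (Arch A Void) Y \<and> emb (Arch A Q) (Y \<oplus> U \<oplus> joins Zs) \<or>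
       emb A Y \<and> \<not> emb (Arch A Void) Y \<and> emb Q (U \<oplus> joins Zs)))"
      unfolding S_def early_lists_def occ_lists_def Un_iff mem_image_Times
      by (auto simp: length_Suc_conv)
    also have "\<dots> \<longleftrightarrow> (\<exists>Y U Zs. Xs = Y # U # Zs \<and> length Zs = r \<and> emb A Y \<and>
      emb (Arch A Q) (Arch Y (U \<oplus> joins Zs)))"
      using emb_first_arch_minimal[of A] emb_first_arch_open[of A] emb_Arch_imp_join[of A Void]
      by (metis join_Void)
    finally show ?thesis .
  qed
  have image: "early_lists A Q r = f ` (avoiders (Arch A Void) \<times> S)"
  proof (intro equalityI subsetI)
    fix Xs assume "Xs \<in> early_lists A Q r"
    then obtain X Zs where X: "Xs = X # Zs" "length Zs = r" "emb (Arch A Q) (X \<oplus> joins Zs)"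
      "emb (Arch A Void) X"
      by (auto simp: early_lists_def occ_lists_def length_Suc_conv)
    then obtain T Y U where T: "X = T \<oplus> Arch Y U" "\<not> emb (Arch A Void) T" "emb A Y"
      using first_occurrence_exists by blast
    then have "emb (Arch A Q) (Arch Y (U \<oplus> joins Zs))"
      using X emb_drop_avoiding by (simp del: emb.simps(3))
    then have "Y # U # Zs \<in> S" using S X T by blast
    then show "Xs \<in> f ` (avoiders (Arch A Void) \<times> S)"
      using X T by (auto simp: f_def avoiders_def intro!: rev_image_eqI[of "(T, Y # U # Zs)"])
  next
    fix Xs assume "Xs \<in> f ` (avoiders (Arch A Void) \<times> S)"
    then obtain T Y U Zs where "Xs = (T \<oplus> Arch Y U) # Zs" "length Zs = r" "emb A Y"
        "emb (Arch A Q) (Arch Y (U \<oplus> joins Zs))" "\<not> emb (Arch A Void) T"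
      by (auto simp: f_def S avoiders_def simp del: emb.simps(3))
    then show "Xs \<in> early_lists A Q r"
      by (simp add: early_lists_def occ_lists_def emb_drop_avoiding emb_atom_Arch del: emb.simps(3))
  qed
  have inj: "inj_on f (avoiders (Arch A Void) \<times> S)"
  proof (rule inj_onI)
    fix z z'
    assume z: "z \<in> avoiders (Arch A Void) \<times> S" "z' \<in> avoiders (Arch A Void) \<times> S" "f z = f z'"
    from z(1) obtain T Y U Zs where 1: "z = (T, Y # U # Zs)" "\<not> emb (Arch A Void) T" "emb A Y"
      by (auto simp: S avoiders_def simp del: emb.simps(3))
    from z(2) obtain T' Y' U' Zs' where 2: "z' = (T', Y' # U' # Zs')" "\<not> emb (Arch A Void) T'" "emb A Y'"
      by (auto simp: S avoiders_def simp del: emb.simps(3))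
    from z(3) have "T \<oplus> Arch Y U = T' \<oplus> Arch Y' U'" "Zs = Zs'"
      unfolding 1(1) 2(1) f_def by auto
    then show "z = z'"
      using first_occurrence_unique[OF 1(2) 2(2) 1(3) 2(3)] 1(1) 2(1) by blast
  qed
  have "weight (f z) = Suc (size (fst z) + weight (snd z))"
    if "z \<in> avoiders (Arch A Void) \<times> S" for z
    using that by (auto simp: S f_def)
  then show ?thesis unfolding image by (rule gf_image[OF inj])
qed

lemma gf_early_lists_rec:
  "gf weight (early_lists A Q r) = fps_X * av_gf (Arch A Void) *
     (gf weight (early_lists A Q (Suc r)) + (av_gf (Arch A Void) - av_gf A) * occ_gf Q r)"
proof -
  let ?D = "{Y. emb A Y \<and> \<not> emb (Arch A Void) Y}"
  let ?g = "\<lambda>(Y, Xs). Y # Xs :: forest list"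
  let ?S = "early_lists A Q (Suc r) \<union> ?g ` (?D \<times> occ_lists r Q)"
  have fin: "finite_levels weight (?g ` (?D \<times> occ_lists r Q))"
    by (rule finite_levels_forest_lists[of _ "Suc (Suc r)"]) (auto simp: occ_lists_def)
  have finS: "finite_levels weight ?S"
    by (rule finite_levels_forest_lists[of _ "Suc (Suc r)"]) (auto simp: occ_lists_def early_lists_def)
  have "gf weight (early_lists A Q r) = gf (\<lambda>z. Suc (size (fst z) + weight (snd z))) (avoiders (Arch A Void) \<times> ?S)"
    by (rule gf_early_lists)
  also have "\<dots> = fps_X * (av_gf (Arch A Void) * gf weight ?S)"
    by (simp only: gf_Suc gf_Times[OF finite_levels_forest finS])
  also have "gf weight ?S = gf weight (early_lists A Q (Suc r)) + gf weight (?g ` (?D \<times> occ_lists r Q))"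
    by (rule gf_Un[OF finite_levels_early_lists fin]) (auto simp: early_lists_def)
  also have "gf weight (?g ` (?D \<times> occ_lists r Q)) =
      gf (\<lambda>z. size (fst z) + weight (snd z)) (?D \<times> occ_lists r Q)"
    by (rule gf_image) (auto simp: inj_on_def)
  also have "\<dots> = (av_gf (Arch A Void) - av_gf A) * occ_gf Q r"
    by (simp only: occ_gf_def gf_Times[OF finite_levels_forest finite_levels_occ_lists] gf_minimal)
  finally show ?thesis by (simp only: mult.assoc)
qed

text \<open>
  Eliminating \<open>early_lists\<close> from \<open>occ_gf_split\<close> and \<open>gf_early_lists_rec\<close> leaves an operator that is
  affine in \<open>neighbour_sum\<close>; this is why the operators of different atoms commute.
\<close>

definition neighbour_sum :: "(nat \<Rightarrow> int fps) \<Rightarrow> nat \<Rightarrow> int fps" where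
  "neighbour_sum f r = fps_X * f (Suc r) + (case r of 0 \<Rightarrow> 0 | Suc r' \<Rightarrow> f r')"

definition peel :: "int fps \<Rightarrow> (nat \<Rightarrow> int fps) \<Rightarrow> nat \<Rightarrow> int fps" where
  "peel \<alpha> f r = (1 + fps_X * \<alpha>\<^sup>2) * f r - \<alpha> * neighbour_sum f r"

lemma occ_gf_rec:
  fixes A Q :: forest
  defines "\<alpha> \<equiv> av_gf (Arch A Void)"
  shows "peel \<alpha> (occ_gf (Arch A Q)) r = (1 - \<alpha> + fps_X * \<alpha>\<^sup>2) * occ_gf Q r"
proof -
  let ?P = "case r of 0 \<Rightarrow> 0 | Suc r' \<Rightarrow> occ_gf (Arch A Q) r'"
  have 1: "occ_gf (Arch A Q) r = gf weight (early_lists A Q r) + \<alpha> * ?P"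
    unfolding \<alpha>_def by (rule occ_gf_split)
  have 2: "occ_gf (Arch A Q) (Suc r) = gf weight (early_lists A Q (Suc r)) + \<alpha> * occ_gf (Arch A Q) r"
    unfolding \<alpha>_def using occ_gf_split[of A Q "Suc r"] by simp
  have 3: "gf weight (early_lists A Q r) =
      fps_X * \<alpha> * (gf weight (early_lists A Q (Suc r)) + (\<alpha> - av_gf A) * occ_gf Q r)"
    unfolding \<alpha>_def by (rule gf_early_lists_rec)
  \<comment> \<open>This turns the factor \<open>fps_X * \<alpha> * (\<alpha> - av_gf A)\<close>
    into \<open>1 - \<alpha> + fps_X * \<alpha>\<^sup>2\<close>, so that \<open>A\<close> enters
    only through \<open>\<alpha>\<close>.\<close>
  have 4: "\<alpha> = 1 + fps_X * av_gf A * \<alpha>"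
    unfolding \<alpha>_def by (rule av_gf_Arch)
  show ?thesis
    unfolding peel_def neighbour_sum_def using 1 2 3 4 by algebra
qed

lemma occ_gf_rec_fun:
  "peel (av_gf (Arch A Void)) (occ_gf (Arch A Q)) =
    (\<lambda>r. (1 - av_gf (Arch A Void) + fps_X * (av_gf (Arch A Void))\<^sup>2) * occ_gf Q r)"
  by (rule ext) (rule occ_gf_rec)

section \<open>Commutation and injectivity of the peeling operators\<close>

lemma neighbour_sum_linear:
  "neighbour_sum (\<lambda>r. c * f r - d * g r) r = c * neighbour_sum f r - d * neighbour_sum g r"
  by (cases r) (simp_all add: neighbour_sum_def algebra_simps)

lemma peel_commute: "peel \<alpha> (peel \<beta> f) r = peel \<beta> (peel \<alpha> f) r"
proof -
  have "neighbour_sum (peel \<gamma> f) r = (1 + fps_X * \<gamma>\<^sup>2) * neighbour_sum f r - \<gamma> * neighbour_sum (neighbour_sum f) r" for \<gamma>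
    using neighbour_sum_linear[of "1 + fps_X * \<gamma>\<^sup>2" f \<gamma> "neighbour_sum f" r] by (simp add: peel_def[abs_def])
  then have "peel \<alpha> (peel \<beta> f) r = (1 + fps_X * \<alpha>\<^sup>2) * peel \<beta> f r -
      \<alpha> * ((1 + fps_X * \<beta>\<^sup>2) * neighbour_sum f r - \<beta> * neighbour_sum (neighbour_sum f) r)" for \<alpha> \<beta>
    unfolding peel_def[of \<alpha> "peel \<beta> f"] by simp
  note * = this
  show ?thesis
    unfolding * peel_def[of \<beta> f r] peel_def[of \<alpha> f r] by (simp add: algebra_simps)
qed

lemma peel_scale: "peel \<alpha> (\<lambda>r. c * f r) r = c * peel \<alpha> f r"
  using neighbour_sum_linear[of c f 0 f r] by (simp add: peel_def algebra_simps)

lemma mult_nth_eq_0: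
  fixes f g :: "int fps"
  assumes "\<And>i. i \<le> n \<Longrightarrow> f $ i = 0"
  shows "(g * f) $ n = 0"
  unfolding fps_mult_nth using assms by simp

text \<open>The equation expresses \<open>f r\<close> as a multiple of \<open>fps_X\<close> plus,
  for positive \<open>r\<close>, \<open>\<alpha>\<close> times the preceding value of
  \<open>f\<close>. Induction on the coefficient index handles the multiple of \<open>fps_X\<close>,
  an inner induction on \<open>r\<close> the other term.\<close>

lemma peel_inj_0:
  assumes "\<And>r. peel \<alpha> f r = 0"
  shows "f r $ n = 0"
proof (induction n arbitrary: r rule: less_induct)
  case (less n)
  have *: "(fps_X * (\<alpha> * f i - \<alpha>\<^sup>2 * f j)) $ n = 0" for i j
  proof (cases n)
    case (Suc m)
    then have "(\<alpha> * f i) $ m = 0" "(\<alpha>\<^sup>2 * f j) $ m = 0"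
      by (auto intro!: mult_nth_eq_0 less.IH)
    then show ?thesis using Suc by simp
  qed simp
  show ?case
  proof (induction r)
    case 0
    have "f 0 = fps_X * (\<alpha> * f 1 - \<alpha>\<^sup>2 * f 0)"
      using assms[of 0] by (simp add: peel_def neighbour_sum_def algebra_simps)
    then show ?case using * by metis
  next
    case (Suc r)
    have "f (Suc r) = fps_X * (\<alpha> * f (Suc (Suc r)) - \<alpha>\<^sup>2 * f (Suc r)) + \<alpha> * f r"
      using assms[of "Suc r"] by (simp add: peel_def neighbour_sum_def algebra_simps)
    moreover have "(\<alpha> * f r) $ n = 0"
      \<comment> \<open>Coefficients of \<open>f r\<close> below \<open>n\<close> vanish by the
        outer induction, the one at \<open>n\<close> by the inner.\<close>
      using Suc less by (intro mult_nth_eq_0) (metis le_neq_implies_less)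
    ultimately show ?case using * by (metis add.right_neutral fps_add_nth)
  qed
qed

lemma peel_inj:
  assumes "\<And>r. peel \<alpha> f r = peel \<alpha> g r"
  shows "f = g"
proof -
  have "peel \<alpha> (\<lambda>r. f r - g r) r = 0" for r
    using assms[of r] by (cases r) (simp_all add: peel_def neighbour_sum_def algebra_simps)
  then have "(f r - g r) $ n = 0" for r n by (rule peel_inj_0)
  then show ?thesis by (intro ext fps_ext) simp
qed

text \<open>By \<open>occ_gf_rec\<close> both series families solve the same peeling equation.
  Agreement is carried for all \<open>r\<close> at once, since the operator couples neighbouring
  values.\<close>

lemma occ_gf_cong_first:
  assumes "av_gf (Arch A Void) = av_gf (Arch B Void)" "occ_gf P = occ_gf Q"
  shows "occ_gf (Arch A P) = occ_gf (Arch B Q)"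
proof (rule peel_inj)
  show "peel (av_gf (Arch A Void)) (occ_gf (Arch A P)) r = peel (av_gf (Arch A Void)) (occ_gf (Arch B Q)) r" for r
    unfolding occ_gf_rec by (simp only: assms occ_gf_rec)
qed

lemma occ_gf_cong_prefix: "occ_gf A = occ_gf B \<Longrightarrow> occ_gf (P \<oplus> A) = occ_gf (P \<oplus> B)"
proof (induction P)
  case (Arch Y X)
  then have "occ_gf (X \<oplus> A) = occ_gf (X \<oplus> B)" by blast
  then show ?case using occ_gf_cong_first[OF HOL.refl, of "X \<oplus> A" "X \<oplus> B" Y] by simp
qed simp

text \<open>Peeling both atoms in either order leaves the same multiple of \<open>occ_gf Q\<close>;
  the operators commute and are cancelled one after the other.\<close>

lemma occ_gf_swap: "occ_gf (Arch A (Arch B Q)) = occ_gf (Arch B (Arch A Q))"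
proof -
  let ?\<alpha> = "av_gf (Arch A Void)" and ?\<beta> = "av_gf (Arch B Void)"
  have two_steps: "peel (av_gf (Arch B Void)) (peel (av_gf (Arch A Void)) (occ_gf (Arch A (Arch B Q)))) r =
    (1 - av_gf (Arch A Void) + fps_X * (av_gf (Arch A Void))\<^sup>2) *
    ((1 - av_gf (Arch B Void) + fps_X * (av_gf (Arch B Void))\<^sup>2) * occ_gf Q r)" for A B r
    by (simp only: occ_gf_rec_fun peel_scale)
  have "peel ?\<beta> (peel ?\<alpha> (occ_gf (Arch A (Arch B Q)))) r = peel ?\<beta> (peel ?\<alpha> (occ_gf (Arch B (Arch A Q)))) r" for r
    unfolding peel_commute[of ?\<beta> ?\<alpha> "occ_gf (Arch B (Arch A Q))"] two_steps by (simp add: mult.left_commute)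
  then have "peel ?\<alpha> (occ_gf (Arch A (Arch B Q))) = peel ?\<alpha> (occ_gf (Arch B (Arch A Q)))"
    by (rule peel_inj)
  then have "peel ?\<alpha> (occ_gf (Arch A (Arch B Q))) r = peel ?\<alpha> (occ_gf (Arch B (Arch A Q))) r" for r by simp
  then show ?thesis by (rule peel_inj)
qed

text \<open>Lists for \<open>r = 0\<close> are single forests, and the first two terms on the right
  add up to the series of all forests.\<close>

lemma av_gf_eq_occ_gf: "av_gf A = av_gf Void + occ_gf Void 0 - occ_gf A 0"
proof -
  have "occ_gf A 0 = gf size {X. emb A X}" for A
  proof -
    have "occ_lists 0 A = (\<lambda>X. [X]) ` {X. emb A X}"
      by (auto simp: occ_lists_def length_Suc_conv)
    moreover have "gf weight ((\<lambda>X. [X]) ` {X. emb A X}) = gf size {X. emb A X}"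
      by (rule gf_image) (auto simp: inj_on_def)
    ultimately show ?thesis by (simp add: occ_gf_def)
  qed
  moreover have "av_gf A = gf size (UNIV - {X. emb A X})"
    by (rule arg_cong[where f = "gf size"]) (auto simp: avoiders_def)
  ultimately show ?thesis by (simp add: gf_Diff finite_levels_forest av_gf_Void)
qed

lemma av_gf_cong_occ_gf: "occ_gf A = occ_gf B \<Longrightarrow> av_gf A = av_gf B"
  using av_gf_eq_occ_gf[of A] av_gf_eq_occ_gf[of B] by metis

text \<open>Let \<open>E\<close> collect the forests containing \<langle>A\<rangle> but not
  \<langle>A\<rangle>\<langle>B\<rangle>. Cutting at the first arch with \<open>A\<close> in its
  contents \<open>Y\<close> leaves an avoider of \<langle>A\<rangle> on the left and one of
  \<langle>B\<rangle> on the right, while \<open>Y\<close> is again in \<open>E\<close> or contains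
  \<open>A\<close> but not \<langle>A\<rangle>. This is a linear equation for the series of
  \<open>E\<close>.\<close>

lemma av_gf_pair_atoms:
  fixes A B
  defines "\<alpha> \<equiv> av_gf (Arch A Void)" and "\<beta> \<equiv> av_gf (Arch B Void)"
  shows "av_gf (Arch A (Arch B Void)) * (1 - fps_X * \<alpha> * \<beta>) = \<alpha> + \<beta> - \<alpha> * \<beta>"
proof -
  let ?a = "Arch A Void" and ?b = "Arch B Void" and ?ab = "Arch A (Arch B Void)"
  define E where "E = {X. emb ?a X \<and> \<not> emb ?ab X}"
  let ?D = "{Y. emb A Y \<and> \<not> emb ?a Y}"
  let ?S = "avoiders ?a \<times> ((E \<union> ?D) \<times> avoiders ?b)"
  let ?f = "\<lambda>z. fst z \<oplus> Arch (fst (snd z)) (snd (snd z))"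
  have S: "(Y \<in> E \<union> ?D \<and> U \<in> avoiders ?b) \<longleftrightarrow> emb A Y \<and> \<not> emb ?ab (Arch Y U)" for Y U
  proof (cases "emb ?a Y")
    case True
    then show ?thesis
      using emb_first_arch_open[OF True, of ?b U] emb_pair_join[OF True, of B U] emb_Arch_imp_join[of A Void Y]
      by (auto simp: E_def avoiders_def simp del: emb.simps(3))
  next
    case False
    then show ?thesis
      using emb_first_arch_minimal[OF _ False, of ?b U]
      by (auto simp: E_def avoiders_def simp del: emb.simps(3))
  qed
  have "E = ?f ` ?S"
  proof (intro equalityI subsetI)
    fix X assume "X \<in> E"
    then obtain T Y U where T: "X = T \<oplus> Arch Y U" "\<not> emb ?a T" "emb A Y" and "\<not> emb ?ab X"
      using first_occurrence_exists unfolding E_def by blast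
    then have "Y \<in> E \<union> ?D \<and> U \<in> avoiders ?b"
      unfolding S using emb_drop_avoiding by blast
    then show "X \<in> ?f ` ?S"
      using T by (intro rev_image_eqI[of "(T, Y, U)"]) (auto simp: avoiders_def)
  next
    fix X assume "X \<in> ?f ` ?S"
    then obtain T Y U where "X = T \<oplus> Arch Y U" "\<not> emb ?a T" "Y \<in> E \<union> ?D \<and> U \<in> avoiders ?b"
      by (auto simp: avoiders_def)
    then show "X \<in> E"
      unfolding S by (simp add: E_def emb_drop_avoiding emb_atom_Arch del: emb.simps(3))
  qed
  moreover have "gf size (?f ` ?S) = gf (\<lambda>z. Suc (size (fst z) + (size (fst (snd z)) + size (snd (snd z))))) ?S"
  proof (rule gf_image)
    have "emb A Y" if "Y \<in> E \<union> ?D" for Y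
      using that emb_Arch_imp_join[of A Void Y] by (auto simp: E_def)
    then show "inj_on ?f ?S"
      by (intro inj_onI) (clarsimp simp: avoiders_def, metis first_occurrence_unique)
  qed simp
  moreover have "\<dots> = fps_X * (\<alpha> * (gf size (E \<union> ?D) * \<beta>))"
    unfolding \<alpha>_def \<beta>_def gf_Suc
    by (subst gf_Times | simp add: finite_levels_forest finite_levels_Times)+
  moreover have "gf size (E \<union> ?D) = gf size E + gf size ?D"
    by (intro gf_Un finite_levels_forest) (auto simp: E_def)
  ultimately have E: "gf size E = fps_X * (\<alpha> * ((gf size E + (\<alpha> - av_gf A)) * \<beta>))"
    using gf_minimal[of A] unfolding \<alpha>_def by simp
  have "avoiders ?ab = E \<union> avoiders ?a"
    using emb_Arch_imp_rest emb_drop_avoiding[of A _ ?b Void]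
    by (auto simp: avoiders_def E_def)
  moreover have "gf size (E \<union> avoiders ?a) = gf size E + \<alpha>"
    unfolding \<alpha>_def by (intro gf_Un finite_levels_forest) (auto simp: E_def avoiders_def)
  ultimately have "av_gf ?ab = gf size E + \<alpha>" by simp
  moreover have "\<alpha> = 1 + fps_X * av_gf A * \<alpha>"
    unfolding \<alpha>_def by (rule av_gf_Arch)
  \<comment> \<open>The atom equation eliminates \<open>av_gf A\<close>, as in
    \<open>occ_gf_rec\<close>.\<close>
  ultimately show ?thesis using E by algebra
qed

section \<open>Enclosing, and the symmetric formula for three atoms\<close>

lemma av_gf_cong_Arch:
  assumes "av_gf A = av_gf B"
  shows "av_gf (Arch A Void) = av_gf (Arch B Void)"
proof -
  have "av_gf (Arch A Void) * (1 - fps_X * av_gf A) = av_gf (Arch B Void) * (1 - fps_X * av_gf A)"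
    using av_gf_Arch[of A] av_gf_Arch[of B] assms by algebra
  moreover have "1 - fps_X * av_gf A \<noteq> 0"
  proof
    assume "1 - fps_X * av_gf A = 0"
    then have "(1 - fps_X * av_gf A) $ 0 = 0" by simp
    then show False by simp
  qed
  ultimately show ?thesis by simp
qed

definition atomic :: "forest \<Rightarrow> bool" where
  "atomic X \<longleftrightarrow> X = Void \<or> (\<exists>Y. X = Arch Y Void)"

text \<open>Since \<open>av_gf Void = 0\<close>, the formula for two atoms stays correct when a
  factor is empty.\<close>

lemma av_gf_pair:
  assumes "atomic a" "atomic b"
  shows "av_gf (a \<oplus> b) * (1 - fps_X * av_gf a * av_gf b) = av_gf a + av_gf b - av_gf a * av_gf b"
  using assms unfolding atomic_def by (auto simp: av_gf_Void av_gf_pair_atoms)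

text \<open>Here \<open>g\<close>, \<open>d\<close> and \<open>t\<close> stand for the series of
  \<open>bc\<close>, \<langle>bc\<rangle> and \<open>a\<close>\<langle>bc\<rangle>. Eliminating
  \<open>d\<close> and then \<open>g\<close> leaves an equation for \<open>t\<close> that is
  symmetric in \<open>a\<close>, \<open>b\<close>, \<open>c\<close>.\<close>

lemma pair_elimination:
  fixes x a b c d g t :: "'a :: comm_ring_1"
  assumes "d = 1 + x * g * d"
    and "t * (1 - x * a * d) = a + d - a * d"
    and "g * (1 - x * b * c) = b + c - b * c"
  shows "t * (1 - x * (a + b + c) + x\<^sup>2 * (a * b * c)) =
    1 - x * (a * b + b * c + a * c) + x * (a * b * c)"
proof -
  have d: "d * (1 - x * g) = 1" using assms(1) by (simp add: algebra_simps)
  have "t * (1 - x * g - x * a) = t * ((1 - x * g) - x * a * (d * (1 - x * g)))"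
    by (simp only: d mult_1_right)
  also have "\<dots> = (t * (1 - x * a * d)) * (1 - x * g)" by (simp add: algebra_simps)
  also have "\<dots> = a * (1 - x * g) + (1 - a) * (d * (1 - x * g))"
    unfolding assms(2) by (simp add: algebra_simps)
  also have "\<dots> = 1 - x * a * g" unfolding d by (simp add: algebra_simps)
  finally have t: "t * (1 - x * g - x * a) = 1 - x * a * g" .
  have "t * (1 - x * (a + b + c) + x\<^sup>2 * (a * b * c)) =
      t * ((1 - x * a) * (1 - x * b * c) - x * (b + c - b * c))"
    by (simp add: algebra_simps power2_eq_square)
  also have "\<dots> = (t * (1 - x * g - x * a)) * (1 - x * b * c)"
    unfolding assms(3)[symmetric] by (simp add: algebra_simps)
  also have "\<dots> = (1 - x * b * c) - x * a * (g * (1 - x * b * c))"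
    unfolding t by (simp add: algebra_simps)
  also have "\<dots> = 1 - x * (a * b + b * c + a * c) + x * (a * b * c)"
    unfolding assms(3) by (simp add: algebra_simps)
  finally show ?thesis .
qed

lemma av_gf_Arch_pair:
  assumes "atomic a" "atomic b" "atomic c"
  shows "av_gf (a \<oplus> Arch (b \<oplus> c) Void) *
      (1 - fps_X * (av_gf a + av_gf b + av_gf c) + fps_X\<^sup>2 * (av_gf a * av_gf b * av_gf c)) =
    1 - fps_X * (av_gf a * av_gf b + av_gf b * av_gf c + av_gf a * av_gf c) + fps_X * (av_gf a * av_gf b * av_gf c)"
proof -
  have "atomic (Arch (b \<oplus> c) Void)" by (simp add: atomic_def)
  then have 1: "av_gf (a \<oplus> Arch (b \<oplus> c) Void) * (1 - fps_X * av_gf a * av_gf (Arch (b \<oplus> c) Void)) =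
      av_gf a + av_gf (Arch (b \<oplus> c) Void) - av_gf a * av_gf (Arch (b \<oplus> c) Void)"
    using av_gf_pair assms by blast
  show ?thesis
    by (rule pair_elimination[OF av_gf_Arch 1 av_gf_pair[OF assms(2,3)]])
qed

section \<open>Invariance of the generating function\<close>

lemma card_Av_word: "int (card {V \<in> Av (word A). arch_size V = n}) = av_gf A $ n"
proof -
  have "{V \<in> Av (word A). arch_size V = n} = word ` {X \<in> avoiders A. size X = n}"
    using arch_system_imp_word by (fastforce simp: Av_def avoiders_def contained_in_word)
  moreover have "inj_on word {X \<in> avoiders A. size X = n}"
    using inj_word by (rule inj_on_subset) simp
  ultimately show ?thesis by (simp add: gf_nth card_image)
qed

lemma atom_or_empty_word:
  assumes "atom_or_empty a"
  obtains X where "a = word X" "atomic X"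
proof (cases "a = []")
  case True
  then show ?thesis using that[of Void] by (simp add: atomic_def)
next
  case False
  then obtain Y where "a = word (Arch Y Void)"
    using assms atom_word unfolding atom_or_empty_def by blast
  then show ?thesis using that[of "Arch Y Void"] by (simp add: atomic_def)
qed

lemma av_gf_cong_context:
  assumes "atomic a" "atomic b" "av_gf a = av_gf b"
  shows "av_gf (P \<oplus> a \<oplus> Q) = av_gf (P \<oplus> b \<oplus> Q)"
proof (cases "a = Void \<or> b = Void")
  case True
  \<comment> \<open>The series distinguishes empty from nonempty patterns, so if one of
    \<open>a\<close> and \<open>b\<close> is empty, both are.\<close>
  have "X = Void \<longleftrightarrow> av_gf X = 0" for X
    using av_gf_Void av_gf_nth_0[of X] by (cases "X = Void") auto
  then have "a = Void \<and> b = Void" using True assms(3) by metis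
  then show ?thesis by simp
next
  case False
  then obtain A B where "a = Arch A Void" "b = Arch B Void"
    using assms(1,2) unfolding atomic_def by blast
  then have "occ_gf (a \<oplus> Q) = occ_gf (b \<oplus> Q)"
    using occ_gf_cong_first[of A B Q Q] assms(3) by simp
  then show ?thesis by (intro av_gf_cong_occ_gf occ_gf_cong_prefix)
qed

lemma av_gf_swap_context:
  assumes "atomic a" "atomic b"
  shows "av_gf (P \<oplus> a \<oplus> b \<oplus> Q) = av_gf (P \<oplus> b \<oplus> a \<oplus> Q)"
proof -
  have "occ_gf (a \<oplus> b \<oplus> Q) = occ_gf (b \<oplus> a \<oplus> Q)"
    using assms occ_gf_swap unfolding atomic_def by auto
  then show ?thesis by (intro av_gf_cong_occ_gf occ_gf_cong_prefix)
qed

text \<open>After \<open>c\<close> is moved to the front, both sides satisfy the same symmetric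
  equation, whose factor \<open>?D\<close> has constant term 1 and can be cancelled.\<close>

lemma av_gf_rotate:
  assumes "atomic a" "atomic b" "atomic c"
  shows "av_gf (a \<oplus> Arch (b \<oplus> c) Void) = av_gf (Arch (a \<oplus> b) Void \<oplus> c)"
proof -
  let ?D = "1 - fps_X * (av_gf a + av_gf b + av_gf c) + fps_X\<^sup>2 * (av_gf a * av_gf b * av_gf c)"
  have "atomic (Arch (a \<oplus> b) Void)" by (simp add: atomic_def)
  then have "av_gf (Arch (a \<oplus> b) Void \<oplus> c) = av_gf (c \<oplus> Arch (a \<oplus> b) Void)"
    using av_gf_swap_context[of "Arch (a \<oplus> b) Void" c Void Void] assms(3) by simp
  moreover have "av_gf (c \<oplus> Arch (a \<oplus> b) Void) * ?D = av_gf (a \<oplus> Arch (b \<oplus> c) Void) * ?D"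
    using av_gf_Arch_pair[OF assms(3,1,2)] av_gf_Arch_pair[OF assms] by (simp add: ac_simps)
  moreover have "?D $ 0 = 1" by (simp add: power2_eq_square)
  then have "?D \<noteq> 0" by (metis fps_zero_nth zero_neq_one)
  ultimately show ?thesis by simp
qed

lemma arch_sim_imp_av_gf_eq:
  "U \<sim> V \<Longrightarrow> \<exists>A B. U = word A \<and> V = word B \<and> av_gf A = av_gf B"
proof (induction rule: arch_sim.induct)
  case (refl U)
  then show ?case using arch_system_imp_word by blast
next
  case (sym U V)
  then show ?case by metis
next
  case (trans U V W)
  then obtain A B B' C where "U = word A" "V = word B" "av_gf A = av_gf B" "V = word B'" "W = word C" "av_gf B' = av_gf C"
    by blast
  \<comment> \<open>The two induction hypotheses give separate forests for the middle word; unique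
    parsing identifies them.\<close>
  moreover from this have "B = B'" using inj_word by (metis injD)
  ultimately show ?case by metis
next
  case (R1 U V)
  then obtain A B where "U = word A" "V = word B" "av_gf A = av_gf B" by blast
  then show ?case
    using av_gf_cong_Arch[of A B] by (intro exI[of _ "Arch A Void"] exI[of _ "Arch B Void"]) simp
next
  case (R2 P Q a b)
  obtain A where A: "a = word A" "atomic A" using R2 atom_or_empty_word by blast
  obtain B where B: "b = word B" "atomic B" using R2 atom_or_empty_word by blast
  obtain P' Q' where PQ: "P = word P'" "Q = word Q'" using R2 arch_system_imp_word by metis
  have "av_gf A = av_gf B" using R2 A(1) B(1) inj_word by (metis injD)
  then have "av_gf (P' \<oplus> A \<oplus> Q') = av_gf (P' \<oplus> B \<oplus> Q')" using A B av_gf_cong_context by blast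
  then show ?case using A B PQ by (metis word_join)
next
  case (R3 P Q a b)
  obtain A where A: "a = word A" "atomic A" using R3 atom_or_empty_word by blast
  obtain B where B: "b = word B" "atomic B" using R3 atom_or_empty_word by blast
  obtain P' Q' where PQ: "P = word P'" "Q = word Q'" using R3 arch_system_imp_word by metis
  have "av_gf (P' \<oplus> A \<oplus> B \<oplus> Q') = av_gf (P' \<oplus> B \<oplus> A \<oplus> Q')" using A B av_gf_swap_context by blast
  then show ?case using A B PQ by (metis word_join)
next
  case (R4 a b c)
  obtain A where A: "a = word A" "atomic A" using R4 atom_or_empty_word by blast
  obtain B where B: "b = word B" "atomic B" using R4 atom_or_empty_word by blast
  obtain C where C: "c = word C" "atomic C" using R4 atom_or_empty_word by blast
  show ?case
    using av_gf_rotate[OF A(2) B(2) C(2)] A(1) B(1) C(1)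
    by (intro exI[of _ "A \<oplus> Arch (B \<oplus> C) Void"] exI[of _ "Arch (A \<oplus> B) Void \<oplus> C"]) simp
qed

theorem mainTheorem1:
  fixes A B :: "paren list"
  assumes "arch_system A" and "arch_system B"
    and "A \<sim> B"
  shows "wilf_equivalent (Av A) (Av B)"
proof -
  obtain X Y where "A = word X" "B = word Y" "av_gf X = av_gf Y"
    using arch_sim_imp_av_gf_eq[OF assms(3)] by blast
  then have "int (card {V \<in> Av A. arch_size V = n}) = int (card {V \<in> Av B. arch_size V = n})" for n
    by (simp only: card_Av_word)
  then show ?thesis unfolding wilf_equivalent_def by simp
qed

end
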